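(* Let $V\in L^\infty(\mathbb{R})$ satisfy $0<v_0\le V(x)\le v_1$ for a.e. $x\in\mathbb{R}$, for some constants $v_0,v_1$. Then $$2\frac{v_0}{\sqrt{v_1}}\le m(V)\le 2\frac{v_1}{\sqrt{v_0}}.$$
   Context: All function spaces are real-valued, $H^1(\mathbb{R})=W^{1,2}(\mathbb{R})$. Write $\|u\|_\infty=\|u\|_{L^\infty(\mathbb{R})}$, $\|u\|_V^2=\int_{\mathbb{R}}(|u'|^2+V|u|^2)\,dx$, and $$m(V):=\inf_{u\in H^1(\mathbb{R}),\,u\not\equiv0}\frac{\|u\|_V^2}{\|u\|_\infty^2}.$$ *)

theory Defs
  imports "HOL-Analysis.Analysis" "HOL-Probability.Essential_Supremum"
begin

text \<open>Elements of the Lebesgue and Sobolev spaces are represented by functions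
  \<open>real \<Rightarrow> real\<close> rather than by classes modulo null sets; every notion below except \<open>test_functions\<close> is
  invariant under changes on a null set.\<close>

definition L2_space :: "(real \<Rightarrow> real) set" where
  "L2_space = {u \<in> borel_measurable lebesgue. integrable lebesgue (\<lambda>x. (u x)\<^sup>2)}"

definition Linf_norm :: "(real \<Rightarrow> real) \<Rightarrow> ereal" where
  "Linf_norm u = esssup lebesgue (\<lambda>x. ereal \<bar>u x\<bar>)"

definition Linf_space :: "(real \<Rightarrow> real) set" where
  "Linf_space = {u \<in> borel_measurable lebesgue. Linf_norm u < \<infinity>}"

definition test_functions :: "(real \<Rightarrow> real) set" where
  "test_functions =
     {\<phi>. (\<forall>n x. ((deriv ^^ n) \<phi>) field_differentiable (at x)) \<and> compact (closure {x. \<phi> x \<noteq> 0})}"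

text \<open>Only used for \<open>u\<close> and \<open>g\<close> in \<open>L2_space\<close>, where both integrands are integrable.\<close>

definition is_weak_deriv :: "(real \<Rightarrow> real) \<Rightarrow> (real \<Rightarrow> real) \<Rightarrow> bool" where
  "is_weak_deriv u g \<longleftrightarrow>
     (\<forall>\<phi>\<in>test_functions. (LINT x|lebesgue. u x * deriv \<phi> x) = - (LINT x|lebesgue. g x * \<phi> x))"

definition H1_space :: "(real \<Rightarrow> real) set" where
  "H1_space = {u \<in> L2_space. \<exists>g\<in>L2_space. is_weak_deriv u g}"

text \<open>Any representative of the weak derivative, which is unique up to null sets.\<close>

definition weak_deriv :: "(real \<Rightarrow> real) \<Rightarrow> real \<Rightarrow> real" where
  "weak_deriv u = (SOME g. g \<in> L2_space \<and> is_weak_deriv u g)"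

definition V_norm_sq :: "(real \<Rightarrow> real) \<Rightarrow> (real \<Rightarrow> real) \<Rightarrow> real" where
  "V_norm_sq V u = (LINT x|lebesgue. \<bar>weak_deriv u x\<bar>\<^sup>2 + V x * \<bar>u x\<bar>\<^sup>2)"

text \<open>The infimum is taken in the extended reals, so that it needs neither a lower bound nor
  finiteness of the \<open>L\<^sup>\<infinity>\<close> norm to be meaningful. The condition \<open>u \<noteq> 0\<close> is that of the class
  of \<open>u\<close>, i.e. \<open>u\<close> does not vanish almost everywhere; hence the denominator is positive.\<close>

definition m_inf :: "(real \<Rightarrow> real) \<Rightarrow> ereal" where
  "m_inf V = (INF u \<in> {u \<in> H1_space. \<not> (AE x in lebesgue. u x = 0)}.
            ereal (V_norm_sq V u) / (Linf_norm u)\<^sup>2)"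

end

theory Submission
  imports Defs "HOL-Probability.Sinc_Integral"
begin

text \<open>
  Behind both bounds is the sharp inequality \<open>2 a \<parallel>u\<parallel>\<^sub>\<infinity>\<^sup>2 \<le> \<integral> \<bar>u'\<bar>\<^sup>2 + a\<^sup>2 \<bar>u\<bar>\<^sup>2\<close> for \<open>a > 0\<close>, with equality for
  \<open>u x = exp (- a \<bar>x\<bar>)\<close>. Since \<open>V \<ge> v0\<close>, the inequality with \<open>a = sqrt v0\<close> gives \<open>m(V) \<ge> 2 sqrt v0\<close>. Since
  \<open>V \<le> v1\<close>, the extremal function with \<open>a = sqrt v1\<close> gives \<open>m(V) \<le> 2 sqrt v1\<close>. Because \<open>v0 \<le> v1\<close>, these
  bounds are at least as strong as the asserted ones.

  For smooth \<open>u\<close> the inequality follows by writing \<open>u(y)\<^sup>2\<close> as the integral of \<open>2 u u'\<close> over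
  \<open>(-\<infinity>, y]\<close> and as that of \<open>- 2 u u'\<close> over \<open>[y, \<infinity>)\<close>, bounding \<open>2 a \<bar>u u'\<bar>\<close> by \<open>\<bar>u'\<bar>\<^sup>2 + a\<^sup>2 \<bar>u\<bar>\<^sup>2\<close> and adding
  the two estimates. For a merely weakly differentiable \<open>u\<close> with weak derivative \<open>g\<close>, this argument is
  applied to the averages \<open>U(y) = \<integral> u(x) \<phi>(x - y) dx\<close> against a nonnegative test function \<open>\<phi>\<close>: the
  definition of the weak derivative says precisely that \<open>U' = \<integral> g(x) \<phi>(x - y) dx\<close>, and averaging
  does not increase the energy, by Cauchy--Schwarz. This is lemma \<open>weak_deriv_test_bound\<close>. Now
  \<open>\<bar>\<integral> u \<phi>\<bar> \<le> K \<integral> \<phi>\<close> for all nonnegative test functions \<open>\<phi>\<close>, so \<open>\<bar>u\<bar> \<le> K\<close> almost everywhere by the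
  fundamental lemma of the calculus of variations (\<open>fundamental_lemma_nonneg\<close>).

  The upper bound needs the same fundamental lemma: \<open>weak_deriv\<close> is an arbitrary choice, and only
  uniqueness of weak derivatives (\<open>weak_deriv_unique\<close>) identifies it with the classical
  derivative of the extremal function.
\<close>

section \<open>Smooth approximation of indicators of open sets\<close>

text \<open>The classical function \<open>exp (-1/x)\<close>, flat at \<open>0\<close>. The polynomial factor makes the
  family closed under differentiation.\<close>

definition flat :: "real poly \<Rightarrow> real \<Rightarrow> real" where
  "flat p x = (if x > 0 then poly p (1 / x) * exp (- (1 / x)) else 0)"

lemma poly_exp_decay: "((\<lambda>y::real. poly p y * exp (- y)) \<longlongrightarrow> 0) at_top"
proof -
  have "((\<lambda>y. \<Sum>i\<le>degree p. coeff p i * (y ^ i / exp y)) \<longlongrightarrow> (\<Sum>i\<le>degree p. coeff p i * 0)) at_top"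
    by (intro tendsto_intros tendsto_power_div_exp_0)
  then show ?thesis
    by (simp add: poly_altdef sum_distrib_right exp_minus divide_inverse mult.assoc)
qed

text \<open>The difference quotient of \<open>flat p\<close> at \<open>0\<close>: it vanishes on the left, and on the right the
  substitution \<open>y = 1/x\<close> turns it into a polynomial times \<open>exp (- y)\<close> at infinity.\<close>

lemma flat_decay: "((\<lambda>x. flat p x / x) \<longlongrightarrow> 0) (at 0)"
proof (rule filterlim_split_at)
  have "((\<lambda>x. poly (pCons 0 p) (inverse x) * exp (- inverse x)) \<longlongrightarrow> 0) (at_right (0::real))"
    by (rule filterlim_compose[OF poly_exp_decay filterlim_inverse_at_top_right])
  then show "((\<lambda>x. flat p x / x) \<longlongrightarrow> 0) (at_right 0)"
    by (rule Lim_transform_eventually)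
       (auto simp: eventually_at_right_less flat_def field_simps intro!: eventually_at_rightI[of 0 1])
  show "((\<lambda>x. flat p x / x) \<longlongrightarrow> 0) (at_left 0)"
    by (rule Lim_transform_eventually[OF tendsto_const])
       (auto simp: flat_def intro!: eventually_at_leftI[of "-1" 0])
qed

lemma flat_deriv:
  "(flat p has_real_derivative flat ([:0, 0, 1:] * (p - pderiv p)) x) (at x)"
proof -
  consider "x > 0" | "x = 0" | "x < 0" by linarith
  then show ?thesis
  proof cases
    case 1
    have "((\<lambda>x. poly p (1 / x) * exp (- (1 / x))) has_real_derivative
        flat ([:0, 0, 1:] * (p - pderiv p)) x) (at x)"
      using 1 by (auto intro!: derivative_eq_intros simp: flat_def field_simps power2_eq_square)
    then show ?thesis
      by (rule DERIV_cong_ev[THEN iffD1, OF refl _ refl, rotated])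
         (use 1 in \<open>auto intro!: eventually_mono[OF eventually_nhds_in_open[of "{0<..}" x]] simp: flat_def\<close>)
  next
    case 2
    then show ?thesis
      using flat_decay[of p] by (simp add: DERIV_def flat_def)
  next
    case 3
    have "((\<lambda>x. 0) has_real_derivative 0) (at x)" by simp
    then have "(flat p has_real_derivative 0) (at x)"
      by (rule DERIV_cong_ev[THEN iffD1, OF refl _ refl, rotated])
         (use 3 in \<open>auto intro!: eventually_mono[OF eventually_nhds_in_open[of "{..<0}" x]] simp: flat_def\<close>)
    then show ?thesis using 3 by (simp add: flat_def)
  qed
qed

text \<open>Smoothness is stated through iterated derivatives. An algebra of differentiable functions that
  contains the derivatives of its members makes it a plain induction, without a Leibniz
  rule for higher derivatives.\<close>

inductive_set flat_algebra :: "(real \<Rightarrow> real) set" where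
  flat: "(\<lambda>x. flat p (a * x + b)) \<in> flat_algebra"
| add: "f \<in> flat_algebra \<Longrightarrow> g \<in> flat_algebra \<Longrightarrow> (\<lambda>x. f x + g x) \<in> flat_algebra"
| diff: "f \<in> flat_algebra \<Longrightarrow> g \<in> flat_algebra \<Longrightarrow> (\<lambda>x. f x - g x) \<in> flat_algebra"
| mult: "f \<in> flat_algebra \<Longrightarrow> g \<in> flat_algebra \<Longrightarrow> (\<lambda>x. f x * g x) \<in> flat_algebra"

lemma flat_algebra_derivative:
  "f \<in> flat_algebra \<Longrightarrow> \<exists>f'\<in>flat_algebra. \<forall>x. (f has_real_derivative f' x) (at x)"
proof (induction rule: flat_algebra.induct)
  case (flat p a b)
  let ?q = "smult a ([:0, 0, 1:] * (p - pderiv p))"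
  have "((\<lambda>x. flat p (a * x + b)) has_real_derivative flat ?q (a * x + b)) (at x)" for x
  proof -
    have "((\<lambda>x. flat p (a * x + b)) has_real_derivative
        flat ([:0, 0, 1:] * (p - pderiv p)) (a * x + b) * a) (at x)"
      by (rule DERIV_chain2[OF flat_deriv]) (auto intro!: derivative_eq_intros)
    moreover have "flat ([:0, 0, 1:] * (p - pderiv p)) (a * x + b) * a = flat ?q (a * x + b)"
      by (simp add: flat_def mult_ac)
    ultimately show ?thesis by simp
  qed
  then show ?case by (intro bexI[OF _ flat_algebra.flat] allI)
next
  case (add f g)
  then obtain f' g' where "f' \<in> flat_algebra" "g' \<in> flat_algebra"
    "\<forall>x. (f has_real_derivative f' x) (at x)" "\<forall>x. (g has_real_derivative g' x) (at x)" by blast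
  then show ?case
    by (intro bexI[of _ "\<lambda>x. f' x + g' x"]) (auto intro: DERIV_add flat_algebra.add)
next
  case (diff f g)
  then obtain f' g' where "f' \<in> flat_algebra" "g' \<in> flat_algebra"
    "\<forall>x. (f has_real_derivative f' x) (at x)" "\<forall>x. (g has_real_derivative g' x) (at x)" by blast
  then show ?case
    by (intro bexI[of _ "\<lambda>x. f' x - g' x"]) (auto intro: DERIV_diff flat_algebra.diff)
next
  case (mult f g)
  then obtain f' g' where "f' \<in> flat_algebra" "g' \<in> flat_algebra"
    "\<forall>x. (f has_real_derivative f' x) (at x)" "\<forall>x. (g has_real_derivative g' x) (at x)" by blast
  then show ?case
    using mult.hyps
    by (intro bexI[of _ "\<lambda>x. f' x * g x + g' x * f x"])
       (auto intro!: DERIV_mult flat_algebra.add flat_algebra.mult)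
qed

lemma flat_algebra_smooth:
  assumes "f \<in> flat_algebra"
  shows "((deriv ^^ n) f) field_differentiable (at x)"
  using assms
proof (induction n arbitrary: f)
  case 0
  then show ?case
    using flat_algebra_derivative field_differentiable_def by fastforce
next
  case (Suc n)
  obtain f' where "f' \<in> flat_algebra" and f': "\<forall>x. (f has_real_derivative f' x) (at x)"
    using flat_algebra_derivative[OF Suc.prems] by blast
  moreover have "deriv f = f'" using f' DERIV_imp_deriv by blast
  ultimately show ?case using Suc.IH by (simp add: funpow_swap1)
qed

text \<open>Rescaling the argument of \<open>exp (-1/x)\<close> by \<open>n + 1\<close> amounts to taking the \<open>(n + 1)\<close>-th root, which
  tends to \<open>1\<close> wherever the function is positive.\<close>

definition bump :: "real \<Rightarrow> real \<Rightarrow> nat \<Rightarrow> real \<Rightarrow> real" where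
  "bump c d n x = flat 1 (real (Suc n) * (x - c)) * flat 1 (real (Suc n) * (d - x))"

lemma bump_in_flat_algebra: "bump c d n \<in> flat_algebra"
proof -
  have *: "(\<lambda>x. flat 1 (real (Suc n) * x + (- real (Suc n) * c)) * flat 1 (- real (Suc n) * x + real (Suc n) * d))
     \<in> flat_algebra"
    by (intro flat_algebra.intros)
  have "bump c d n = (\<lambda>x. flat 1 (real (Suc n) * x + (- real (Suc n) * c)) * flat 1 (- real (Suc n) * x + real (Suc n) * d))"
    unfolding bump_def by (intro ext) (simp add: algebra_simps)
  with * show ?thesis by simp
qed

lemma flat_one_range: "0 \<le> flat 1 x" "flat 1 x \<le> 1"
  by (auto simp: flat_def)

lemma bump_range: "0 \<le> bump c d n x" "bump c d n x \<le> 1"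
  using flat_one_range by (auto simp: bump_def intro: mult_le_one)

lemma bump_outside: "x \<notin> {c<..<d} \<Longrightarrow> bump c d n x = 0"
  by (auto simp: bump_def flat_def zero_less_mult_iff)

lemma bump_inside:
  assumes "x \<in> {c<..<d}"
  shows "(\<lambda>n. bump c d n x) \<longlonglongrightarrow> 1"
proof -
  have *: "(\<lambda>n. flat 1 (real (Suc n) * y)) \<longlonglongrightarrow> 1" if "y > 0" for y
  proof -
    have "(\<lambda>n. exp (- (1 / y * inverse (real (Suc n))))) \<longlonglongrightarrow> exp (- (1 / y * 0))"
      by (intro tendsto_intros LIMSEQ_inverse_real_of_nat)
    moreover have "flat 1 (real (Suc n) * y) = exp (- (1 / y * inverse (real (Suc n))))" for n
      using that by (simp add: flat_def inverse_eq_divide mult.commute del: of_nat_Suc)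
    ultimately show ?thesis by simp
  qed
  have "(\<lambda>n. bump c d n x) \<longlonglongrightarrow> 1 * 1"
    unfolding bump_def using assms by (intro tendsto_mult *) auto
  then show ?thesis by simp
qed

text \<open>An open set is a countable union of intervals \<open>I\<^sub>k\<close>. If \<open>B\<^sub>k\<close> is a bump on \<open>I\<^sub>k\<close>, then
  \<open>1 - (\<Prod>k<N. 1 - B\<^sub>k)\<close> is a smooth counterpart of the indicator of \<open>\<Union>k<N. I\<^sub>k\<close>, even if the intervals
  overlap. Increasing the number of intervals and sharpening the bumps at the same time
  gives the approximation.\<close>

lemma test_approx_open:
  fixes U :: "real set"
  assumes "open U" "bounded U"
  obtains \<phi> where "\<And>n. \<phi> n \<in> test_functions" "\<And>n x. 0 \<le> \<phi> n x" "\<And>n x. \<phi> n x \<le> 1"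
    "\<And>n x. x \<notin> U \<Longrightarrow> \<phi> n x = 0" "\<And>x. x \<in> U \<Longrightarrow> (\<lambda>n. \<phi> n x) \<longlonglongrightarrow> 1"
proof -
  obtain D where D: "countable D" "\<And>X. X \<in> D \<Longrightarrow> \<exists>a b. X = box a b" "\<Union>D = U"
    using open_countable_Union_open_box[OF \<open>open U\<close>] by metis
  \<comment> \<open>The empty set is added only to have something to enumerate when \<open>U\<close> is empty.\<close>
  have "\<forall>k. \<exists>c d. from_nat_into (insert {} D) k = {c<..<d::real}"
    by (metis D(2) box_real(1) from_nat_into greaterThanLessThan_empty insertE insert_not_empty
        order_refl)
  then obtain c d where cd: "\<And>k. from_nat_into (insert {} D) k = {c k<..<d k}" by metis
  have "(\<Union>k. {c k<..<d k}) = U"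
    using range_from_nat_into[of "insert {} D"] D(1,3) by (simp flip: cd)
  note U = this
  define \<psi> where "\<psi> N n x = 1 - (\<Prod>k<N. 1 - bump (c k) (d k) n x)" for N n x
  have "\<psi> N n \<in> flat_algebra" for N n
  proof (induction N)
    case 0
    then show ?case using flat_algebra.flat[of 0 0 0] by (simp add: \<psi>_def flat_def)
  next
    case (Suc N)
    have "\<psi> (Suc N) n = (\<lambda>x. \<psi> N n x + bump (c N) (d N) n x - \<psi> N n x * bump (c N) (d N) n x)"
      by (auto simp: \<psi>_def algebra_simps)
    then show ?case using Suc bump_in_flat_algebra flat_algebra.intros by simp
  qed
  note alg = this
  have prod_range: "0 \<le> (\<Prod>k\<in>A. 1 - bump (c k) (d k) n x)" "(\<Prod>k\<in>A. 1 - bump (c k) (d k) n x) \<le> 1" for A n x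
    using bump_range by (auto intro!: prod_nonneg prod_le_1)
  have out: "\<psi> N n x = 0" if "x \<notin> U" for N n x
    using that U bump_outside unfolding \<psi>_def by (subst prod.neutral) auto
  show ?thesis
  proof
    fix n
    have "bounded {x. \<psi> n n x \<noteq> 0}"
      by (rule bounded_subset[OF \<open>bounded U\<close>]) (use out in blast)
    then show "\<psi> n n \<in> test_functions"
      using flat_algebra_smooth[OF alg] by (auto simp: test_functions_def compact_closure)
  next
    fix x assume "x \<in> U"
    then obtain k where k: "x \<in> {c k<..<d k}" using U by blast
    have "(\<lambda>n. 1 - \<psi> n n x) \<longlonglongrightarrow> 0"
    proof (rule tendsto_sandwich[OF _ _ tendsto_const])
      show "\<forall>\<^sub>F n in sequentially. 0 \<le> 1 - \<psi> n n x"
        using prod_range by (simp add: \<psi>_def)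
      show "\<forall>\<^sub>F n in sequentially. 1 - \<psi> n n x \<le> 1 - bump (c k) (d k) n x"
        using eventually_gt_at_top[of k]
      proof eventually_elim
        case (elim n)
        have "(\<Prod>j<n. 1 - bump (c j) (d j) n x)
            = (1 - bump (c k) (d k) n x) * (\<Prod>j\<in>{..<n} - {k}. 1 - bump (c j) (d j) n x)"
          using elim by (intro prod.remove) auto
        also have "\<dots> \<le> 1 - bump (c k) (d k) n x"
          using prod_range bump_range(2)[of "c k" "d k" n x] by (intro mult_left_le) auto
        finally show ?case by (simp add: \<psi>_def)
      qed
      show "(\<lambda>n. 1 - bump (c k) (d k) n x) \<longlonglongrightarrow> 0"
        using tendsto_diff[OF tendsto_const[of 1] bump_inside[OF k]] by simp
    qed
    from tendsto_diff[OF tendsto_const[of 1] this] show "(\<lambda>n. \<psi> n n x) \<longlonglongrightarrow> 1" by simp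
  qed (use prod_range out in \<open>auto simp: \<psi>_def\<close>)
qed

section \<open>The fundamental lemma of the calculus of variations\<close>

lemma test_functionD:
  assumes "\<phi> \<in> test_functions"
  shows test_function_DERIV: "(\<phi> has_real_derivative deriv \<phi> x) (at x)"
    and continuous_test_function: "continuous_on S \<phi>"
    and deriv_in_test_functions: "deriv \<phi> \<in> test_functions"
proof -
  have d: "((deriv ^^ n) \<phi>) field_differentiable (at x)" for n x
    using assms by (simp add: test_functions_def)
  show "(\<phi> has_real_derivative deriv \<phi> x) (at x)"
    using d[of 0 x] by (simp add: field_differentiable_derivI)
  show "continuous_on S \<phi>"
    using d[of 0] by (auto intro!: continuous_at_imp_continuous_on field_differentiable_imp_continuous_at)
  have "deriv \<phi> x = 0" if "x \<notin> closure {x. \<phi> x \<noteq> 0}" for x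
  proof -
    have "\<forall>\<^sub>F y in nhds x. y \<in> - closure {x. \<phi> x \<noteq> 0}"
      using that by (intro eventually_nhds_in_open) auto
    then have "\<forall>\<^sub>F y in nhds x. 0 = \<phi> y"
      by (rule eventually_mono) (use closure_subset[of "{x. \<phi> x \<noteq> 0}"] in auto)
    then have "(\<phi> has_real_derivative 0) (at x)"
      by (rule DERIV_cong_ev[THEN iffD1, OF refl _ refl]) simp
    then show ?thesis by (rule DERIV_imp_deriv)
  qed
  then have "closure {x. deriv \<phi> x \<noteq> 0} \<subseteq> closure {x. \<phi> x \<noteq> 0}"
    by (intro closure_minimal) auto
  moreover have "compact (closure {x. \<phi> x \<noteq> 0})" using assms by (simp add: test_functions_def)
  ultimately have "compact (closure {x. deriv \<phi> x \<noteq> 0})"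
    by (meson closed_closure compact_closure compact_imp_bounded bounded_subset closure_subset)
  then show "deriv \<phi> \<in> test_functions"
    using d[of "Suc _"] by (simp add: test_functions_def funpow_swap1)
qed

lemma test_function_bounds:
  assumes "\<phi> \<in> test_functions"
  obtains R B where "R > 0" "B > 0" "\<And>x. x \<notin> {-R..R} \<Longrightarrow> \<phi> x = 0" "\<And>x. \<bar>\<phi> x\<bar> \<le> B * indicator {-R..R} x"
proof -
  have "bounded {x. \<phi> x \<noteq> 0}"
    using assms compact_closure by (auto simp: test_functions_def)
  then obtain R where R: "R > 0" "\<And>x. \<phi> x \<noteq> 0 \<Longrightarrow> norm x \<le> R"
    unfolding bounded_pos by auto
  have "compact (\<phi> ` {-R..R})"
    by (intro compact_continuous_image continuous_test_function assms) auto
  then obtain B where B: "B > 0" "\<And>x. x \<in> {-R..R} \<Longrightarrow> norm (\<phi> x) \<le> B"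
    by (metis compact_imp_bounded bounded_pos image_eqI)
  have out: "x \<notin> {-R..R} \<Longrightarrow> \<phi> x = 0" for x
    using R(2)[of x] by (cases "\<phi> x = 0") (auto simp: abs_le_iff)
  show ?thesis
    using out R B by (intro that[of R B]) (auto simp: indicator_def)
qed

lemma test_function_measurable:
  "\<phi> \<in> test_functions \<Longrightarrow> \<phi> \<in> borel_measurable borel"
  by (rule borel_measurable_continuous_onI) (rule continuous_test_function)

definition locally_integrable :: "(real \<Rightarrow> real) \<Rightarrow> bool" where
  "locally_integrable f \<longleftrightarrow> f \<in> borel_measurable lebesgue \<and>
     (\<forall>R. integrable lebesgue (\<lambda>x. indicator {-R..R} x * f x))"

lemma borel_measurable_lebesgueI: "f \<in> borel_measurable borel \<Longrightarrow> f \<in> borel_measurable lebesgue"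
  by (simp add: measurable_completion)

lemma locally_integrable_mult_test:
  assumes "locally_integrable f" "\<phi> \<in> test_functions"
  shows "integrable lebesgue (\<lambda>x. f x * \<phi> x)"
proof -
  obtain R B where RB: "R > 0" "B > 0" "\<And>x. x \<notin> {-R..R} \<Longrightarrow> \<phi> x = 0" "\<And>x. \<bar>\<phi> x\<bar> \<le> B * indicator {-R..R} x"
    using test_function_bounds[OF assms(2)] by metis
  have [measurable]: "f \<in> borel_measurable lebesgue" "\<phi> \<in> borel_measurable lebesgue"
    using assms test_function_measurable by (auto simp: locally_integrable_def intro!: borel_measurable_lebesgueI)
  show ?thesis
  proof (rule Bochner_Integration.integrable_bound)
    show "integrable lebesgue (\<lambda>x. B * (indicator {-R..R} x * f x))"
      using assms(1) by (auto simp: locally_integrable_def)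
    have "\<bar>f x\<bar> * \<bar>\<phi> x\<bar> \<le> \<bar>f x\<bar> * (B * indicator {-R..R} x)" for x
      by (intro mult_left_mono RB) auto
    then show "AE x in lebesgue. norm (f x * \<phi> x) \<le> norm (B * (indicator {-R..R} x * f x))"
      using RB by (auto simp: abs_mult mult_ac)
  qed measurable
qed

text \<open>Dominated convergence along test functions between \<open>0\<close> and \<open>1\<close> that converge to the indicator of \<open>U\<close>.\<close>

lemma integral_open_nonneg:
  assumes f: "locally_integrable f"
    and pos: "\<And>\<phi>. \<phi> \<in> test_functions \<Longrightarrow> (\<And>x. 0 \<le> \<phi> x) \<Longrightarrow> 0 \<le> (LINT x|lebesgue. f x * \<phi> x)"
    and U: "open U" "U \<subseteq> {-R..R}"
  shows "0 \<le> (LINT x|lebesgue. indicator U x * f x)"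
proof -
  have "bounded U" using U(2) bounded_closed_interval bounded_subset by blast
  obtain \<phi> where \<phi>: "\<And>n. \<phi> n \<in> test_functions" "\<And>n x. 0 \<le> \<phi> n x" "\<And>n x. \<phi> n x \<le> 1"
    "\<And>n x. x \<notin> U \<Longrightarrow> \<phi> n x = 0" "\<And>x. x \<in> U \<Longrightarrow> (\<lambda>n. \<phi> n x) \<longlonglongrightarrow> 1"
    using test_approx_open[OF U(1) \<open>bounded U\<close>] by metis
  have [measurable]: "f \<in> borel_measurable lebesgue" "U \<in> sets lebesgue"
    using f U by (auto simp: locally_integrable_def)
  have [measurable]: "\<phi> n \<in> borel_measurable lebesgue" for n
    using test_function_measurable[OF \<phi>(1)] by (rule borel_measurable_lebesgueI)
  have "(\<lambda>n. LINT x|lebesgue. f x * \<phi> n x) \<longlonglongrightarrow> (LINT x|lebesgue. indicator U x * f x)"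
  proof (rule integral_dominated_convergence)
    show "integrable lebesgue (\<lambda>x. \<bar>indicator {-R..R} x * f x\<bar>)"
      using f by (auto simp: locally_integrable_def)
    have "(\<lambda>n. f x * \<phi> n x) \<longlonglongrightarrow> indicator U x * f x" for x
      using tendsto_mult[OF tendsto_const \<phi>(5), of x "f x"] \<phi>(4) by (cases "x \<in> U") auto
    then show "AE x in lebesgue. (\<lambda>n. f x * \<phi> n x) \<longlonglongrightarrow> indicator U x * f x" by simp
    have "norm (f x * \<phi> n x) \<le> \<bar>indicator {-R..R} x * f x\<bar>" for n x
      using \<phi>(2,3)[of n x] \<phi>(4)[of x n] U(2) mult_left_le[of "\<phi> n x" "\<bar>f x\<bar>"]
      by (cases "x \<in> U") (auto simp: abs_mult subset_iff)
    then show "AE x in lebesgue. norm (f x * \<phi> n x) \<le> \<bar>indicator {-R..R} x * f x\<bar>" for n by simp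
  qed measurable
  then show ?thesis
    by (rule LIMSEQ_le_const) (use pos \<phi> in blast)
qed

text \<open>The set \<open>N\<close> where \<open>f < 0\<close>, cut off to a bounded interval, agrees up to a null set with a
  decreasing intersection of bounded open sets. Hence the integral of \<open>f\<close> over \<open>N\<close> is a limit of
  nonnegative integrals over open sets, while the integrand is negative on \<open>N\<close>; so \<open>N\<close> is a null set.\<close>

lemma fundamental_lemma_nonneg:
  assumes f: "locally_integrable f"
    and pos: "\<And>\<phi>. \<phi> \<in> test_functions \<Longrightarrow> (\<And>x. 0 \<le> \<phi> x) \<Longrightarrow> 0 \<le> (LINT x|lebesgue. f x * \<phi> x)"
  shows "AE x in lebesgue. 0 \<le> f x"
proof -
  have [measurable]: "f \<in> borel_measurable lebesgue" using f by (simp add: locally_integrable_def)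
  have "AE x in lebesgue. x \<in> {-R<..<R} \<longrightarrow> 0 \<le> f x" for R
  proof -
    define N where "N = (f -` {..<0} \<inter> space lebesgue) \<inter> {-R<..<R}"
    have [measurable]: "N \<in> sets lebesgue"
      unfolding N_def by (intro sets.Int measurable_sets[of f lebesgue borel]) auto
    obtain C T where C: "gdelta C" "T \<in> null_sets lebesgue" "N \<union> T = C"
      using lebesgue_set_almost_gdelta[OF \<open>N \<in> sets lebesgue\<close>] by metis
    from C(1) obtain F :: "nat \<Rightarrow> real set" where F: "\<And>n. open (F n)" "C = \<Inter>(range F)"
      by (auto elim!: gdelta.cases)
    define U where "U n = (\<Inter>k\<le>n. F k) \<inter> {-R<..<R}" for n
    have U: "open (U n)" "U n \<subseteq> {-R..R}" for n
      using F(1) by (auto simp: U_def intro!: open_Int open_INT)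
    have [measurable]: "U n \<in> sets lebesgue" for n using U(1) by simp
    have ind: "AE x in lebesgue. (\<lambda>n. indicator (U n) x :: real) \<longlonglongrightarrow> indicator N x"
      using AE_not_in[OF C(2)]
    proof eventually_elim
      case (elim x)
      show ?case
      proof (cases "x \<in> N")
        case True
        then have "x \<in> C" "x \<in> {-R<..<R}" using C(3) by (auto simp: N_def)
        then have "x \<in> U n" for n using F(2) by (auto simp: U_def)
        then show ?thesis using True by simp
      next
        case False
        show ?thesis
        proof (cases "x \<in> {-R<..<R}")
          case True
          have "x \<notin> C" using elim False C(3) by blast
          then obtain k where "x \<notin> F k" using F(2) by blast
          then have "\<forall>\<^sub>F n in sequentially. indicator N x = (indicator (U n) x :: real)"
            using False by (intro eventually_sequentiallyI[of k]) (auto simp: U_def indicator_def)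
          then show ?thesis by (rule Lim_transform_eventually[OF tendsto_const])
        qed (use False in \<open>simp add: U_def\<close>)
      qed
    qed
    have "(\<lambda>n. LINT x|lebesgue. indicator (U n) x * f x) \<longlonglongrightarrow> (LINT x|lebesgue. indicator N x * f x)"
    proof (rule integral_dominated_convergence)
      show "integrable lebesgue (\<lambda>x. \<bar>indicator {-R..R} x * f x\<bar>)"
        using f by (auto simp: locally_integrable_def)
      show "AE x in lebesgue. (\<lambda>n. indicator (U n) x * f x) \<longlonglongrightarrow> indicator N x * f x"
        using ind by eventually_elim (rule tendsto_mult_right)
      show "AE x in lebesgue. norm (indicator (U n) x * f x) \<le> \<bar>indicator {-R..R} x * f x\<bar>" for n
        using U(2)[of n] by (intro AE_I2) (auto simp: indicator_def)
    qed measurable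
    then have ge: "0 \<le> (LINT x|lebesgue. indicator N x * f x)"
      by (rule LIMSEQ_le_const) (use integral_open_nonneg[OF f pos U] in blast)
    have int: "integrable lebesgue (\<lambda>x. indicator N x * f x)"
    proof (rule Bochner_Integration.integrable_bound)
      show "integrable lebesgue (\<lambda>x. indicator {-R..R} x * f x)"
        using f by (auto simp: locally_integrable_def)
      show "(\<lambda>x. indicator N x * f x) \<in> borel_measurable lebesgue" by measurable
    qed (auto simp: indicator_def N_def)
    have nonneg: "0 \<le> - (indicator N x * f x)" for x
      by (auto simp: indicator_def N_def)
    have "(LINT x|lebesgue. - (indicator N x * f x)) = 0"
      using ge Bochner_Integration.integral_nonneg[of lebesgue "\<lambda>x. - (indicator N x * f x)"] nonneg by simp
    then have "AE x in lebesgue. - (indicator N x * f x) = 0"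
      using integral_nonneg_eq_0_iff_AE[of lebesgue "\<lambda>x. - (indicator N x * f x)"] int nonneg by simp
    then show ?thesis
      by eventually_elim (auto simp: indicator_def N_def split: if_splits)
  qed
  then have "AE x in lebesgue. \<forall>n::nat. x \<in> {-real n<..<real n} \<longrightarrow> 0 \<le> f x"
    by (subst AE_all_countable) simp
  then show ?thesis
  proof eventually_elim
    case (elim x)
    obtain n where "\<bar>x\<bar> < real n" using reals_Archimedean2 by blast
    then show ?case using elim by (auto simp: abs_less_iff)
  qed
qed

section \<open>Averages against translated test functions\<close>

lemma funpow_deriv_translate:
  fixes f :: "real \<Rightarrow> real"
  shows "(deriv ^^ n) (\<lambda>x. f (x - y)) = (\<lambda>x. (deriv ^^ n) f (x - y))"
proof (induction n)
  case (Suc n)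
  have "deriv (\<lambda>x. h (x - y)) x = deriv h (x - y)" for h :: "real \<Rightarrow> real" and x
    using DERIV_shift[of h _ x "-y"] by (simp add: deriv_def)
  then show ?case using Suc by auto
qed simp

lemma deriv_translate: "deriv (\<lambda>x. f (x - y)) = (\<lambda>x. deriv f (x - y))" for f :: "real \<Rightarrow> real"
  using funpow_deriv_translate[of 1] by simp

lemma test_function_translate:
  assumes "\<phi> \<in> test_functions"
  shows "(\<lambda>x. \<phi> (x - y)) \<in> test_functions"
proof -
  obtain R B where "R > 0" and out: "\<And>x. x \<notin> {-R..R} \<Longrightarrow> \<phi> x = 0"
    using test_function_bounds[OF assms] by metis
  have "(\<lambda>x. (deriv ^^ n) \<phi> (x - y)) field_differentiable (at x)" for n x
  proof -
    have "(deriv ^^ n) \<phi> field_differentiable (at (x + - y))"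
      using assms by (simp add: test_functions_def)
    then show ?thesis
      unfolding field_differentiable_def DERIV_shift by simp
  qed
  moreover have "{x. \<phi> (x - y) \<noteq> 0} \<subseteq> {y - R..y + R}"
    using out by force
  then have "bounded {x. \<phi> (x - y) \<noteq> 0}"
    using bounded_closed_interval bounded_subset by blast
  ultimately show ?thesis
    by (auto simp: test_functions_def funpow_deriv_translate compact_closure)
qed

lemma measurable_translate:
  "p \<in> borel_measurable borel \<Longrightarrow> (\<lambda>x::real. p (x - y) :: real) \<in> borel_measurable lebesgue"
  by (intro borel_measurable_lebesgueI) (rule measurable_compose[of _ _ borel], auto)

lemma integral_translate:
  fixes p :: "real \<Rightarrow> real"
  assumes "p \<in> borel_measurable borel"
  shows "(LINT x|lebesgue. p (x - y)) = (LINT x|lebesgue. p x)"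
proof -
  have "(LINT x|lborel. p (x - y)) = (LINT x|lborel. p x)"
    using lborel_integral_real_affine[of 1 p "-y"] by (simp add: add.commute)
  moreover have "(\<lambda>x. p (x - y)) \<in> borel_measurable lborel"
    using assms by (auto intro: measurable_compose[of _ _ borel])
  ultimately show ?thesis
    using assms by (simp add: integral_completion)
qed

text \<open>Differentiation under the integral sign. The mean value theorem bounds the difference quotients
  of \<open>p\<close> by its derivative, so that dominated convergence applies.\<close>

lemma DERIV_integral_translate:
  fixes w p p' D :: "real \<Rightarrow> real"
  assumes w[measurable]: "w \<in> borel_measurable lebesgue"
    and p: "\<And>x. (p has_real_derivative p' x) (at x)" and p': "p' \<in> borel_measurable borel"
    and int: "\<And>h. \<bar>h\<bar> \<le> 1 \<Longrightarrow> integrable lebesgue (\<lambda>x. w x * p (x - (y + h)))"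
    and D: "integrable lebesgue D" "\<And>x h. \<bar>h\<bar> \<le> 1 \<Longrightarrow> \<bar>w x * p' (x - (y + h))\<bar> \<le> D x"
  shows "((\<lambda>y. LINT x|lebesgue. w x * p (x - y)) has_real_derivative
           - (LINT x|lebesgue. w x * p' (x - y))) (at y)"
proof -
  define q where "q x h = (w x * p (x - (y + h)) - w x * p (x - y)) / h" for x h
  have "p \<in> borel_measurable borel"
    using p by (intro borel_measurable_continuous_onI continuous_at_imp_continuous_on ballI)
       (auto intro: DERIV_isCont)
  note [measurable] = measurable_translate[OF this] measurable_translate[OF p']
  have der: "((\<lambda>h. w x * p (x - (y + h))) has_real_derivative - (w x * p' (x - (y + h)))) (at h within S)" for x h S
    by (auto intro!: derivative_eq_intros DERIV_chain2[OF p])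
  have bound: "\<bar>q x h\<bar> \<le> D x" if "h \<in> {-1..1} - {0}" for x h
  proof -
    have "norm (w x * p (x - (y + h)) - w x * p (x - (y + 0))) \<le> D x * norm (h - 0)"
      by (rule field_differentiable_bound[where S = "{-1..1}" and f' = "\<lambda>h. - (w x * p' (x - (y + h)))"])
         (use that der D(2) in \<open>auto simp: abs_le_iff\<close>)
    then show ?thesis using that by (simp add: q_def abs_mult field_simps)
  qed
  \<comment> \<open>The limit is taken within \<open>[-1, 1]\<close>, where the domination is available, so that it can be tested on sequences staying there.\<close>
  have "((\<lambda>h. LINT x|lebesgue. q x h) \<longlongrightarrow> (LINT x|lebesgue. - (w x * p' (x - y)))) (at 0 within {-1..1})"
    unfolding tendsto_at_iff_sequentially
  proof (intro allI impI)
    fix X :: "nat \<Rightarrow> real" assume X: "\<forall>i. X i \<in> {-1..1} - {0}" "X \<longlonglongrightarrow> 0"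
    have "(\<lambda>n. LINT x|lebesgue. q x (X n)) \<longlonglongrightarrow> (LINT x|lebesgue. - (w x * p' (x - y)))"
    proof (rule integral_dominated_convergence[OF _ _ D(1)])
      have "(\<lambda>n. q x (X n)) \<longlonglongrightarrow> - (w x * p' (x - y))" for x
      proof -
        have "(q x \<longlongrightarrow> - (w x * p' (x - y))) (at 0)"
          using der[of x 0 UNIV] by (simp add: DERIV_def q_def[abs_def])
        moreover have "filterlim X (at 0) sequentially"
          using X by (auto simp: filterlim_at)
        ultimately show ?thesis by (rule filterlim_compose)
      qed
      then show "AE x in lebesgue. (\<lambda>n. q x (X n)) \<longlonglongrightarrow> - (w x * p' (x - y))" by simp
      show "AE x in lebesgue. norm (q x (X n)) \<le> D x" for n
        using bound X(1) by simp
    qed (auto simp: q_def)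
    then show "((\<lambda>h. LINT x|lebesgue. q x h) \<circ> X) \<longlonglongrightarrow> (LINT x|lebesgue. - (w x * p' (x - y)))"
      by (simp add: o_def)
  qed
  moreover have "at 0 within {-1..1} = at (0::real)"
    by (rule at_within_interior) (simp add: interior_atLeastAtMost_real)
  moreover have "\<forall>\<^sub>F h in at 0. (LINT x|lebesgue. q x h) =
      ((LINT x|lebesgue. w x * p (x - (y + h))) - (LINT x|lebesgue. w x * p (x - y))) / h"
    unfolding eventually_at
    by (intro exI[of _ 1]) (use int int[of 0] in \<open>simp add: q_def\<close>)
  ultimately show ?thesis
    unfolding DERIV_def using Lim_transform_eventually by fastforce
qed

lemma DERIV_integral_test_translate:
  assumes u: "locally_integrable u" and \<phi>: "\<phi> \<in> test_functions"
  shows "((\<lambda>y. LINT x|lebesgue. u x * \<phi> (x - y)) has_real_derivative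
           - (LINT x|lebesgue. u x * deriv \<phi> (x - y))) (at y)"
proof -
  obtain R B where RB: "R > 0" "B > 0" "\<And>x. \<bar>deriv \<phi> x\<bar> \<le> B * indicator {-R..R} x"
    using test_function_bounds[OF deriv_in_test_functions[OF \<phi>]] by metis
  let ?R = "R + \<bar>y\<bar> + 1"
  show ?thesis
  proof (rule DERIV_integral_translate[where D = "\<lambda>x. B * \<bar>indicator {-?R..?R} x * u x\<bar>"])
    show "integrable lebesgue (\<lambda>x. B * \<bar>indicator {-?R..?R} x * u x\<bar>)"
      using u unfolding locally_integrable_def by (intro integrable_mult_right integrable_abs) blast
    fix x h :: real assume h: "\<bar>h\<bar> \<le> 1"
    have "\<bar>u x * deriv \<phi> (x - (y + h))\<bar> \<le> \<bar>u x\<bar> * (B * indicator {-R..R} (x - (y + h)))"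
      unfolding abs_mult by (intro mult_left_mono RB) auto
    also have "\<dots> \<le> \<bar>u x\<bar> * (B * indicator {-?R..?R} x)"
      using h RB(2) by (intro mult_left_mono) (auto simp: indicator_def)
    finally show "\<bar>u x * deriv \<phi> (x - (y + h))\<bar> \<le> B * \<bar>indicator {-?R..?R} x * u x\<bar>"
      by (simp add: abs_mult mult_ac)
  qed (use u \<phi> in \<open>auto simp: locally_integrable_def intro!: test_function_DERIV test_function_measurable
        deriv_in_test_functions locally_integrable_mult_test test_function_translate\<close>)
qed

lemma L2_spaceD:
  assumes "u \<in> L2_space"
  shows "u \<in> borel_measurable lebesgue" "integrable lebesgue (\<lambda>x. (u x)\<^sup>2)"
  using assms by (auto simp: L2_space_def)

lemma locally_integrable_const: "locally_integrable (\<lambda>x. c)"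
proof -
  have "integrable lebesgue (\<lambda>x. indicator {-R..R} x * c)" for R :: real
    by (intro integrable_mult_left integrable_real_indicator) (auto simp: emeasure_lborel_Icc_eq)
  then show ?thesis by (simp add: locally_integrable_def)
qed

lemma locally_integrable_add:
  "locally_integrable f \<Longrightarrow> locally_integrable g \<Longrightarrow> locally_integrable (\<lambda>x. f x + g x)"
  by (auto simp: locally_integrable_def distrib_left)

lemma locally_integrable_cmult:
  "locally_integrable f \<Longrightarrow> locally_integrable (\<lambda>x. c * f x)"
  by (auto simp: locally_integrable_def mult.left_commute[of _ c])

lemma integrable_imp_locally_integrable:
  assumes "integrable lebesgue f"
  shows "locally_integrable f"
  unfolding locally_integrable_def
proof (intro conjI allI)
  show "f \<in> borel_measurable lebesgue" using assms by simp
  show "integrable lebesgue (\<lambda>x. indicator {-R..R} x * f x)" for R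
    using integrable_mult_indicator[of "{-R..R}" lebesgue f] assms by simp
qed

lemma L2_imp_locally_integrable:
  assumes "u \<in> L2_space"
  shows "locally_integrable u"
proof -
  have [measurable]: "u \<in> borel_measurable lebesgue" using L2_spaceD[OF assms] by simp
  have "integrable lebesgue (\<lambda>x. indicator {-R..R} x * u x)" for R
  proof (rule Bochner_Integration.integrable_bound)
    show "integrable lebesgue (\<lambda>x. indicator {-R..R} x * 1 + (u x)\<^sup>2)"
      using locally_integrable_const[of 1] L2_spaceD(2)[OF assms]
      unfolding locally_integrable_def by (intro Bochner_Integration.integrable_add) auto
    \<comment> \<open>From \<open>(\<bar>v\<bar> - 1)\<^sup>2 \<ge> 0\<close>.\<close>
    have "\<bar>v\<bar> \<le> 1 + v\<^sup>2" for v :: real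
      using zero_le_power2[of "\<bar>v\<bar> - 1"] zero_le_power2[of v] unfolding power2_diff by simp
    then show "AE x in lebesgue. norm (indicator {-R..R} x * u x) \<le> norm (indicator {-R..R} x * 1 + (u x)\<^sup>2)"
      by (auto simp: indicator_def)
  qed (intro borel_measurable_times borel_measurable_indicator, auto)
  then show ?thesis by (simp add: locally_integrable_def)
qed

text \<open>Expanding the nonnegative integral of \<open>(v - t)\<^sup>2 \<phi>\<close> gives a quadratic polynomial in \<open>t\<close>; the
  inequality is its value at the minimum \<open>t = \<integral> v \<phi> / \<integral> \<phi>\<close>.\<close>

lemma Cauchy_Schwarz_weighted:
  assumes v: "v \<in> L2_space" and \<phi>: "\<phi> \<in> test_functions" "\<And>x. 0 \<le> \<phi> x"
  shows "(LINT x|lebesgue. v x * \<phi> x)\<^sup>2 \<le> (LINT x|lebesgue. \<phi> x) * (LINT x|lebesgue. (v x)\<^sup>2 * \<phi> x)"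
    (is "?U\<^sup>2 \<le> ?m * ?A")
proof -
  have int: "integrable lebesgue (\<lambda>x. v x * \<phi> x)" "integrable lebesgue (\<lambda>x. (v x)\<^sup>2 * \<phi> x)" "integrable lebesgue \<phi>"
    using locally_integrable_mult_test[OF L2_imp_locally_integrable[OF v] \<phi>(1)]
      locally_integrable_mult_test[OF integrable_imp_locally_integrable[OF L2_spaceD(2)[OF v]] \<phi>(1)]
      locally_integrable_mult_test[OF locally_integrable_const[of 1] \<phi>(1)] by auto
  have quad: "0 \<le> ?A - 2 * t * ?U + t\<^sup>2 * ?m" for t
  proof -
    have "0 \<le> (LINT x|lebesgue. (v x - t)\<^sup>2 * \<phi> x)"
      by (intro Bochner_Integration.integral_nonneg) (simp add: \<phi>)
    also have "\<dots> = (LINT x|lebesgue. (v x)\<^sup>2 * \<phi> x - 2 * t * (v x * \<phi> x) + t\<^sup>2 * \<phi> x)"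
      by (intro Bochner_Integration.integral_cong) (auto simp: power2_eq_square algebra_simps)
    also have "\<dots> = ?A - 2 * t * ?U + t\<^sup>2 * ?m"
      using int by simp
    finally show ?thesis .
  qed
  have "?m \<ge> 0" by (simp add: \<phi>)
  show ?thesis
  \<comment> \<open>If \<open>\<integral> \<phi> = 0\<close>, the quadratic is affine in \<open>t\<close>, and a nonnegative affine function has slope \<open>0\<close>.\<close>
  proof (cases "?m = 0")
    case True
    have "?U = 0"
    proof (rule ccontr)
      assume "?U \<noteq> 0"
      then show False using quad[of "(?A + 1) / (2 * ?U)"] True by simp
    qed
    then show ?thesis using True by simp
  next
    case False
    then show ?thesis
      using quad[of "?U / ?m"] \<open>?m \<ge> 0\<close> by (simp add: power2_eq_square field_simps)
  qed
qed

text \<open>Integrating \<open>P (x - y)\<close> against a function measures its mass to the right of \<open>y\<close>, smeared out by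
  \<open>\<phi>\<close>. Working with these smeared masses avoids integrating averages over \<open>y\<close>, hence Fubini.\<close>

lemma test_function_antiderivative:
  assumes \<phi>: "\<phi> \<in> test_functions" "\<And>x. 0 \<le> \<phi> x"
  obtains P R where "\<And>x. (P has_real_derivative \<phi> x) (at x)"
    "\<And>x. 0 \<le> P x" "\<And>x. P x \<le> (LINT x|lebesgue. \<phi> x)"
    "\<And>x. x \<le> -R \<Longrightarrow> P x = 0" "\<And>x. x \<ge> R \<Longrightarrow> P x = (LINT x|lebesgue. \<phi> x)"
proof -
  obtain R B where R: "R > 0" "\<And>x. x \<notin> {-R..R} \<Longrightarrow> \<phi> x = 0"
    using test_function_bounds[OF \<phi>(1)] by metis
  have "\<exists>F. \<forall>x::real. - \<infinity> < ereal x \<longrightarrow> ereal x < \<infinity> \<longrightarrow> (F has_vector_derivative \<phi> x) (at x)"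
    by (rule einterval_antiderivative)
       (auto intro: DERIV_isCont[OF test_function_DERIV[OF \<phi>(1)]])
  then obtain F where F: "\<And>x. (F has_real_derivative \<phi> x) (at x)"
    by (auto simp: has_real_derivative_iff_has_vector_derivative)
  have mono: "F x \<le> F y" if "x \<le> y" for x y
    using DERIV_nonneg_imp_nondecreasing[OF that] F \<phi>(2) by blast
  have const: "F x = F y" if "x < y" "\<And>z. x < z \<Longrightarrow> z < y \<Longrightarrow> z \<notin> {-R..R}" for x y
  proof (rule DERIV_isconst_end[OF that(1), symmetric])
    show "continuous_on {x..y} F"
      using F by (intro continuous_at_imp_continuous_on ballI) (auto intro: DERIV_isCont)
    show "(F has_real_derivative 0) (at z)" if "x < z" "z < y" for z
      using F[of z] R(2)[OF \<open>\<And>z. x < z \<Longrightarrow> z < y \<Longrightarrow> z \<notin> {-R..R}\<close>[OF that]] by simp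
  qed
  have lo: "F x = F (-R)" if "x \<le> -R" for x
    using const[of x "-R"] that by (cases "x = -R") auto
  have hi: "F x = F R" if "x \<ge> R" for x
    using const[of R x] that by (cases "x = R") auto
  have "(\<phi> has_integral (F R - F (-R))) {-R..R}"
    using R(1) F by (intro fundamental_theorem_of_calculus)
      (auto simp: has_real_derivative_iff_has_vector_derivative intro: has_vector_derivative_at_within)
  then have "(\<phi> has_integral (F R - F (-R))) UNIV"
    by (rule has_integral_on_superset) (use R in auto)
  moreover have "integrable lebesgue \<phi>"
    using locally_integrable_mult_test[OF locally_integrable_const[of 1] \<phi>(1)] by simp
  ultimately have m: "(LINT x|lebesgue. \<phi> x) = F R - F (-R)"
    using has_integral_integral_lebesgue has_integral_unique by blast
  show ?thesis
  proof (rule that[of "\<lambda>x. F x - F (-R)" R])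
    fix x
    show "((\<lambda>x. F x - F (-R)) has_real_derivative \<phi> x) (at x)"
      using DERIV_diff[OF F DERIV_const] by simp
    show "0 \<le> F x - F (-R)" using lo[of x] mono[of "-R" x] by linarith
    show "F x - F (-R) \<le> (LINT x|lebesgue. \<phi> x)" using hi[of x] mono[of x R] m by linarith
    show "F x - F (-R) = 0" if "x \<le> -R" using lo[OF that] by simp
    show "F x - F (-R) = (LINT x|lebesgue. \<phi> x)" if "x \<ge> R" using hi[OF that] m by simp
  qed
qed

section \<open>The sup-norm bound and uniqueness of weak derivatives\<close>

text \<open>The one-sided estimates for the average \<open>U\<close> are obtained in differential form. Let \<open>J(y)\<close> be
  the energy \<open>\<integral> (g\<^sup>2 + a\<^sup>2 u\<^sup>2)\<close> to the right of \<open>y\<close>, smeared by \<open>\<phi>\<close>, and \<open>m = \<integral> \<phi>\<close>. By Cauchy--Schwarz,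
  \<open>\<bar>2 a U U'\<bar> \<le> - m J'\<close>. So \<open>a U\<^sup>2 + m J\<close> decreases and \<open>a U\<^sup>2 - m J\<close> increases; comparing their values
  at \<open>0\<close> with their limits at \<open>-\<infinity>\<close> and \<open>\<infinity>\<close> and adding the two inequalities eliminates \<open>J(0)\<close>.\<close>

lemma weak_deriv_test_bound:
  assumes u: "u \<in> L2_space" and g: "g \<in> L2_space" and weak: "is_weak_deriv u g"
    and \<phi>: "\<phi> \<in> test_functions" "\<And>x. 0 \<le> \<phi> x" and a: "a > 0"
  shows "2 * a * (LINT x|lebesgue. u x * \<phi> x)\<^sup>2
           \<le> (LINT x|lebesgue. \<phi> x)\<^sup>2 * (LINT x|lebesgue. (g x)\<^sup>2 + a\<^sup>2 * (u x)\<^sup>2)"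
proof -
  define m where "m = (LINT x|lebesgue. \<phi> x)"
  define w where "w x = (g x)\<^sup>2 + a\<^sup>2 * (u x)\<^sup>2" for x
  define W where "W = (LINT x|lebesgue. w x)"
  define U where "U y = (LINT x|lebesgue. u x * \<phi> (x - y))" for y
  define G where "G y = (LINT x|lebesgue. g x * \<phi> (x - y))" for y
  define H where "H y = (LINT x|lebesgue. w x * \<phi> (x - y))" for y
  note u2 = L2_spaceD(2)[OF u] and g2 = L2_spaceD(2)[OF g]
  have w: "integrable lebesgue w" unfolding w_def using u2 g2 by simp
  have w0: "w x \<ge> 0" for x by (simp add: w_def)
  have [measurable]: "w \<in> borel_measurable lebesgue" using w by simp
  have "m \<ge> 0" by (simp add: m_def \<phi>)
  note tr = test_function_translate[OF \<phi>(1)]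
  have mass: "(LINT x|lebesgue. \<phi> (x - y)) = m" for y
    unfolding m_def by (rule integral_translate) (rule test_function_measurable[OF \<phi>(1)])
  obtain P R where P: "\<And>x. (P has_real_derivative \<phi> x) (at x)" "\<And>x. 0 \<le> P x" "\<And>x. P x \<le> m"
    "\<And>x. x \<le> -R \<Longrightarrow> P x = 0" "\<And>x. x \<ge> R \<Longrightarrow> P x = m"
    using test_function_antiderivative[OF \<phi>] unfolding m_def by metis
  have "P \<in> borel_measurable borel"
    using P(1) by (intro borel_measurable_continuous_onI continuous_at_imp_continuous_on ballI)
       (auto intro: DERIV_isCont)
  note [measurable] = measurable_translate[OF this]
    measurable_translate[OF test_function_measurable[OF \<phi>(1)]]
  obtain R' B where RB: "B > 0" "\<And>x. x \<notin> {-R'..R'} \<Longrightarrow> \<phi> x = 0" "\<And>x. \<bar>\<phi> x\<bar> \<le> B * indicator {-R'..R'} x"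
    using test_function_bounds[OF \<phi>(1)] by metis
  have B: "\<bar>\<phi> x\<bar> \<le> B" for x
    using RB(3)[of x] RB(1) by (cases "x \<in> {-R'..R'}") auto
  have wB: "\<bar>w x * \<phi> y\<bar> \<le> B * w x" for x y
    using mult_left_mono[OF B[of y] w0[of x]] w0[of x] by (simp add: abs_mult mult.commute)
  have wP: "\<bar>w x * P y\<bar> \<le> m * w x" for x y
    using mult_left_mono[OF P(3)[of y] w0[of x]] P(2)[of y] w0[of x] by (simp add: abs_mult mult.commute)
  have wP_int: "integrable lebesgue (\<lambda>x. w x * P (x - y))" for y
  proof (rule Bochner_Integration.integrable_bound)
    show "integrable lebesgue (\<lambda>x. m * w x)" using w by simp
    show "AE x in lebesgue. norm (w x * P (x - y)) \<le> norm (m * w x)"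
      using wP by (intro AE_I2) (simp add: order_trans[OF wP])
  qed measurable
  define J where "J y = (LINT x|lebesgue. w x * P (x - y))" for y
  have J': "(J has_real_derivative - H y) (at y)" for y
    unfolding J_def H_def
  proof (rule DERIV_integral_translate[where D = "\<lambda>x. B * w x"])
    show "integrable lebesgue (\<lambda>x. B * w x)" using w by simp
  qed (use P(1) wP_int wB in \<open>auto intro: test_function_measurable[OF \<phi>(1)]\<close>)
  \<comment> \<open>The weak derivative enters here, tested with the translate of \<open>\<phi>\<close>.\<close>
  have U': "(U has_real_derivative G y) (at y)" for y
  proof -
    have "(LINT x|lebesgue. u x * deriv \<phi> (x - y)) = - G y"
      using bspec[OF weak[unfolded is_weak_deriv_def] tr[of y]] by (simp add: G_def deriv_translate)
    then show ?thesis
      using DERIV_integral_test_translate[OF L2_imp_locally_integrable[OF u] \<phi>(1), of y]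
      by (simp add: U_def[abs_def])
  qed
  have CS: "(LINT x|lebesgue. v x * \<phi> (x - y))\<^sup>2 \<le> m * (LINT x|lebesgue. (v x)\<^sup>2 * \<phi> (x - y))"
    if "v \<in> L2_space" for v y
    using Cauchy_Schwarz_weighted[OF that tr[of y]] \<phi>(2) by (simp add: mass)
  have sq_int: "integrable lebesgue (\<lambda>x. (v x)\<^sup>2 * \<phi> (x - y))" if "v \<in> L2_space" for v y
    using locally_integrable_mult_test[OF integrable_imp_locally_integrable[OF L2_spaceD(2)[OF that]] tr] .
  \<comment> \<open>\<open>\<bar>2 (a U) G\<bar> \<le> G\<^sup>2 + (a U)\<^sup>2\<close>, and each square of an average is at most \<open>m\<close> times the average of the square.\<close>
  have slope: "\<bar>2 * a * (U y * G y)\<bar> \<le> m * H y" for y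
  proof -
    have "\<bar>2 * a * (U y * G y)\<bar> \<le> (G y)\<^sup>2 + a\<^sup>2 * (U y)\<^sup>2"
      using zero_le_power2[of "a * U y - G y"] zero_le_power2[of "a * U y + G y"]
      by (simp add: abs_le_iff power2_eq_square algebra_simps)
    also have "\<dots> \<le> m * (LINT x|lebesgue. (g x)\<^sup>2 * \<phi> (x - y)) + a\<^sup>2 * (m * (LINT x|lebesgue. (u x)\<^sup>2 * \<phi> (x - y)))"
      unfolding U_def G_def by (intro add_mono mult_left_mono CS u g) auto
    also have "\<dots> = m * H y"
      using sq_int[OF u, of y] sq_int[OF g, of y] unfolding H_def w_def
      by (simp add: distrib_right distrib_left mult.assoc mult.left_commute)
    finally show ?thesis .
  qed
  have far: "(\<lambda>n. \<phi> (x - real n)) \<longlonglongrightarrow> 0" "(\<lambda>n. \<phi> (x + real n)) \<longlonglongrightarrow> 0"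
    "(\<lambda>n. P (x - real n)) \<longlonglongrightarrow> 0" "(\<lambda>n. P (x + real n)) \<longlonglongrightarrow> m" for x
  proof -
    have ev: "\<forall>\<^sub>F n in sequentially. \<bar>x\<bar> + \<bar>R\<bar> + \<bar>R'\<bar> < real n"
      by (rule filterlim_at_top_dense[THEN iffD1, rule_format, OF filterlim_real_sequentially])
    show "(\<lambda>n. \<phi> (x - real n)) \<longlonglongrightarrow> 0"
      by (rule tendsto_eventually, rule eventually_mono[OF ev], rule RB(2)) auto
    show "(\<lambda>n. \<phi> (x + real n)) \<longlonglongrightarrow> 0"
      by (rule tendsto_eventually, rule eventually_mono[OF ev], rule RB(2)) auto
    show "(\<lambda>n. P (x - real n)) \<longlonglongrightarrow> 0"
      by (rule tendsto_eventually, rule eventually_mono[OF ev], rule P(4)) auto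
    show "(\<lambda>n. P (x + real n)) \<longlonglongrightarrow> m"
      by (rule tendsto_eventually, rule eventually_mono[OF ev], rule P(5)) auto
  qed
  \<comment> \<open>\<open>U\<^sup>2\<close> is dominated by averages of the integrable function \<open>u\<^sup>2\<close>, which vanish at infinity.\<close>
  have U_lim: "(\<lambda>n. U (s n)) \<longlonglongrightarrow> 0" if s: "\<And>x. (\<lambda>n. \<phi> (x - s n)) \<longlonglongrightarrow> 0" for s :: "nat \<Rightarrow> real"
  proof -
    have [measurable]: "u \<in> borel_measurable lebesgue" using L2_spaceD(1)[OF u] .
    have "(\<lambda>n. LINT x|lebesgue. (u x)\<^sup>2 * \<phi> (x - s n)) \<longlonglongrightarrow> (LINT x::real|lebesgue. (0::real))"
    proof (rule integral_dominated_convergence)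
      show "integrable lebesgue (\<lambda>x. B * (u x)\<^sup>2)" using u2 by simp
      show "AE x in lebesgue. (\<lambda>n. (u x)\<^sup>2 * \<phi> (x - s n)) \<longlonglongrightarrow> 0"
        using tendsto_mult_right_zero[OF s] by (intro AE_I2) simp
      show "AE x in lebesgue. norm ((u x)\<^sup>2 * \<phi> (x - s n)) \<le> B * (u x)\<^sup>2" for n
        using mult_right_mono[OF B zero_le_power2] by (intro AE_I2) (simp add: abs_mult mult.commute)
    qed measurable
    then have lim: "(\<lambda>n. m * (LINT x|lebesgue. (u x)\<^sup>2 * \<phi> (x - s n))) \<longlonglongrightarrow> 0"
      by (intro tendsto_mult_right_zero) simp
    have "(\<lambda>n. (U (s n))\<^sup>2) \<longlonglongrightarrow> 0"
      by (rule tendsto_sandwich[OF _ _ tendsto_const lim]) (simp_all add: U_def CS[OF u])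
    then have "(\<lambda>n. sqrt ((U (s n))\<^sup>2)) \<longlonglongrightarrow> sqrt 0" by (rule tendsto_real_sqrt)
    then show ?thesis by (simp add: tendsto_rabs_zero_iff)
  qed
  have J_lim: "(\<lambda>n. J (s n)) \<longlonglongrightarrow> W * l" if s: "\<And>x. (\<lambda>n. P (x - s n)) \<longlonglongrightarrow> l" for s :: "nat \<Rightarrow> real" and l
  proof -
    have "(\<lambda>n. LINT x|lebesgue. w x * P (x - s n)) \<longlonglongrightarrow> (LINT x|lebesgue. w x * l)"
    proof (rule integral_dominated_convergence)
      show "integrable lebesgue (\<lambda>x. m * w x)" using w by simp
      show "AE x in lebesgue. (\<lambda>n. w x * P (x - s n)) \<longlonglongrightarrow> w x * l"
        using tendsto_mult_left[OF s] by (intro AE_I2) simp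
      show "AE x in lebesgue. norm (w x * P (x - s n)) \<le> m * w x" for n
        using wP by (intro AE_I2) simp
    qed measurable
    then show ?thesis by (simp add: J_def W_def)
  qed
  have left: "a * (U 0)\<^sup>2 + m * J 0 \<le> m * (W * m)"
  proof -
    have mono: "a * (U 0)\<^sup>2 + m * J 0 \<le> a * (U (- real n))\<^sup>2 + m * J (- real n)" for n
    proof (rule DERIV_nonpos_imp_nonincreasing[where f = "\<lambda>y. a * (U y)\<^sup>2 + m * J y"])
      fix y
      have "((\<lambda>y. a * (U y)\<^sup>2 + m * J y) has_real_derivative 2 * a * (U y * G y) - m * H y) (at y)"
        by (auto intro!: derivative_eq_intros U' J' simp: mult_ac)
      then show "\<exists>d. ((\<lambda>y. a * (U y)\<^sup>2 + m * J y) has_real_derivative d) (at y) \<and> d \<le> 0"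
        using slope[of y] by (intro exI conjI) (assumption, linarith)
    qed simp
    have lim: "(\<lambda>n. a * (U (- real n))\<^sup>2 + m * J (- real n)) \<longlonglongrightarrow> a * 0\<^sup>2 + m * (W * m)"
      using far(2,4) by (intro tendsto_intros U_lim J_lim) auto
    have "a * (U 0)\<^sup>2 + m * J 0 \<le> a * 0\<^sup>2 + m * (W * m)"
      by (rule LIMSEQ_le_const[OF lim]) (use mono in blast)
    then show ?thesis by simp
  qed
  have right: "a * (U 0)\<^sup>2 - m * J 0 \<le> 0"
  proof -
    have mono: "a * (U 0)\<^sup>2 - m * J 0 \<le> a * (U (real n))\<^sup>2 - m * J (real n)" for n
    proof (rule DERIV_nonneg_imp_nondecreasing[where f = "\<lambda>y. a * (U y)\<^sup>2 - m * J y"])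
      fix y
      have "((\<lambda>y. a * (U y)\<^sup>2 - m * J y) has_real_derivative 2 * a * (U y * G y) + m * H y) (at y)"
        by (auto intro!: derivative_eq_intros U' J' simp: mult_ac)
      then show "\<exists>d. ((\<lambda>y. a * (U y)\<^sup>2 - m * J y) has_real_derivative d) (at y) \<and> 0 \<le> d"
        using slope[of y] by (intro exI conjI) (assumption, linarith)
    qed simp
    have lim: "(\<lambda>n. a * (U (real n))\<^sup>2 - m * J (real n)) \<longlonglongrightarrow> a * 0\<^sup>2 - m * (W * 0)"
      using far(1,3) by (intro tendsto_intros U_lim J_lim) auto
    have "a * (U 0)\<^sup>2 - m * J 0 \<le> a * 0\<^sup>2 - m * (W * 0)"
      by (rule LIMSEQ_le_const[OF lim]) (use mono in blast)
    then show ?thesis by simp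
  qed
  have "2 * a * (U 0)\<^sup>2 \<le> m\<^sup>2 * W"
    using left right by (simp add: power2_eq_square mult_ac)
  then show ?thesis by (simp add: U_def m_def W_def w_def)
qed

text \<open>Applying the fundamental lemma to \<open>K + u\<close> and \<open>K - u\<close>, where \<open>K\<close> is the right-hand side, turns the
  bound on averages of \<open>u\<close> into a pointwise one.\<close>

lemma weak_deriv_sup_bound:
  assumes u: "u \<in> L2_space" and g: "g \<in> L2_space" and weak: "is_weak_deriv u g" and a: "a > 0"
  shows "AE x in lebesgue. \<bar>u x\<bar> \<le> sqrt ((LINT x|lebesgue. (g x)\<^sup>2 + a\<^sup>2 * (u x)\<^sup>2) / (2 * a))"
    (is "AE x in lebesgue. \<bar>u x\<bar> \<le> ?K")
proof -
  note uloc = L2_imp_locally_integrable[OF u]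
  have pos: "0 \<le> (LINT x|lebesgue. (?K + c * u x) * \<phi> x)"
    if c: "\<bar>c\<bar> = 1" and \<phi>: "\<phi> \<in> test_functions" "\<And>x. 0 \<le> \<phi> x" for c \<phi>
  proof -
    let ?U = "LINT x|lebesgue. u x * \<phi> x" and ?m = "LINT x|lebesgue. \<phi> x"
    let ?W = "LINT x|lebesgue. (g x)\<^sup>2 + a\<^sup>2 * (u x)\<^sup>2"
    have "?U\<^sup>2 \<le> ?m\<^sup>2 * (?W / (2 * a))"
      using weak_deriv_test_bound[OF u g weak \<phi> a] a by (simp add: field_simps)
    then have "\<bar>?U\<bar> \<le> sqrt (?m\<^sup>2 * (?W / (2 * a)))"
      using real_sqrt_le_mono by fastforce
    also have "\<dots> = ?m * ?K"
      using \<phi>(2) by (simp only: real_sqrt_mult real_sqrt_abs) simp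
    finally have "\<bar>c * ?U\<bar> \<le> ?m * ?K" using c by (simp add: abs_mult)
    moreover have "(LINT x|lebesgue. (?K + c * u x) * \<phi> x) = ?K * ?m + c * ?U"
      using locally_integrable_mult_test[OF uloc \<phi>(1)]
        locally_integrable_mult_test[OF locally_integrable_const[of 1] \<phi>(1)]
      by (simp add: distrib_right mult.assoc)
    ultimately show ?thesis by (simp add: mult.commute)
  qed
  have *: "AE x in lebesgue. 0 \<le> ?K + c * u x" if "\<bar>c\<bar> = 1" for c
  proof (rule fundamental_lemma_nonneg)
    show "locally_integrable (\<lambda>x. ?K + c * u x)"
      by (intro locally_integrable_add locally_integrable_const locally_integrable_cmult uloc)
  qed (rule pos[OF that])
  have "AE x in lebesgue. 0 \<le> ?K + 1 * u x" "AE x in lebesgue. 0 \<le> ?K + (-1) * u x"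
    by (rule *; simp)+
  then show ?thesis
    by eventually_elim linarith
qed

lemma weak_deriv_unique:
  assumes g: "g \<in> L2_space" "is_weak_deriv u g" and h: "h \<in> L2_space" "is_weak_deriv u h"
  shows "AE x in lebesgue. g x = h x"
proof -
  have "AE x in lebesgue. 0 \<le> g' x + (-1) * h' x"
    if "g' \<in> L2_space" "is_weak_deriv u g'" "h' \<in> L2_space" "is_weak_deriv u h'" for g' h'
  proof (rule fundamental_lemma_nonneg)
    note loc = L2_imp_locally_integrable[OF that(1)] L2_imp_locally_integrable[OF that(3)]
    then show "locally_integrable (\<lambda>x. g' x + (-1) * h' x)"
      by (intro locally_integrable_add locally_integrable_cmult)
    show "0 \<le> (LINT x|lebesgue. (g' x + (-1) * h' x) * \<phi> x)" if \<phi>: "\<phi> \<in> test_functions" for \<phi>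
    proof -
      have "(LINT x|lebesgue. g' x * \<phi> x) = (LINT x|lebesgue. h' x * \<phi> x)"
        using bspec[OF \<open>is_weak_deriv u g'\<close>[unfolded is_weak_deriv_def] \<phi>]
          bspec[OF \<open>is_weak_deriv u h'\<close>[unfolded is_weak_deriv_def] \<phi>] by simp
      then show ?thesis
        using loc[THEN locally_integrable_mult_test, OF \<phi>] by (simp add: left_diff_distrib)
    qed
  qed
  from this[OF g h] this[OF h g] show ?thesis
    by eventually_elim simp
qed

section \<open>The extremal function\<close>

lemma has_bochner_integral_exp_abs:
  assumes "c > 0"
  shows "has_bochner_integral lborel (\<lambda>x::real. exp (- (c * \<bar>x\<bar>))) (2 / c)"
proof -
  have pos: "has_bochner_integral lborel (\<lambda>x::real. exp (- x) * indicator {0..} x) 1"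
    using has_bochner_integral_I0i_power_exp_m'[of 0] by simp
  then have neg: "has_bochner_integral lborel (\<lambda>x::real. exp x * indicator {0..} (- x)) 1"
    using lborel_has_bochner_integral_real_affine_iff[of "-1" "\<lambda>x::real. exp (- x) * indicator {0..} x" 1 0] by simp
  have "has_bochner_integral lborel (\<lambda>x::real. exp (- \<bar>x\<bar>)) (1 + 1)"
  proof (rule has_bochner_integral_cong_AE[THEN iffD1, OF _ _ _ has_bochner_integral_add[OF pos neg]])
    show "AE x::real in lborel. exp (- x) * indicator {0..} x + exp x * indicator {0..} (- x) = exp (- \<bar>x\<bar>)"
      using AE_lborel_singleton[of "0::real"] by eventually_elim (auto simp: indicator_def)
  qed auto
  then show ?thesis
    using lborel_has_bochner_integral_real_affine_iff[of c "\<lambda>x::real. exp (- \<bar>x\<bar>)" 2 0] assms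
    by (simp add: abs_mult divide_inverse mult.commute)
qed

definition peak :: "real \<Rightarrow> real \<Rightarrow> real" where
  "peak a x = exp (- (a * \<bar>x\<bar>))"

definition peak_deriv :: "real \<Rightarrow> real \<Rightarrow> real" where
  "peak_deriv a x = - (a * sgn x * peak a x)"

lemma peak_measurable: "peak a \<in> borel_measurable borel" "peak_deriv a \<in> borel_measurable borel"
  unfolding peak_def[abs_def] peak_deriv_def[abs_def] by measurable

lemma peak_sq:
  assumes "a > 0"
  shows "integrable lebesgue (\<lambda>x. (peak a x)\<^sup>2)" "(LINT x|lebesgue. (peak a x)\<^sup>2) = 1 / a"
proof -
  have "(\<lambda>x. (peak a x)\<^sup>2) = (\<lambda>x. exp (- ((2 * a) * \<bar>x\<bar>)))"
    by (auto simp: peak_def mult.assoc simp flip: exp_double)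
  then have *: "has_bochner_integral lborel (\<lambda>x. (peak a x)\<^sup>2) (1 / a)"
    using has_bochner_integral_exp_abs[of "2 * a"] assms by simp
  have "(\<lambda>x. (peak a x)\<^sup>2) \<in> borel_measurable lborel"
    using peak_measurable(1)[of a] by simp
  then show "integrable lebesgue (\<lambda>x. (peak a x)\<^sup>2)" "(LINT x|lebesgue. (peak a x)\<^sup>2) = 1 / a"
    using * by (auto simp: integrable_completion integral_completion has_bochner_integral_iff)
qed

text \<open>The exception is \<open>x = 0\<close>, where \<open>sgn x = 0\<close>.\<close>

lemma peak_deriv_sq: "AE x in lebesgue. (peak_deriv a x)\<^sup>2 = a\<^sup>2 * (peak a x)\<^sup>2"
proof -
  have "AE x in lebesgue. x \<noteq> (0::real)"
    by (rule AE_completion[OF AE_lborel_singleton])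
  then show ?thesis
    by eventually_elim (auto simp: peak_deriv_def power_mult_distrib sgn_if)
qed

lemma peak_deriv_sq_integrable:
  assumes "a > 0"
  shows "integrable lebesgue (\<lambda>x. (peak_deriv a x)\<^sup>2)"
    "(LINT x|lebesgue. (peak_deriv a x)\<^sup>2) = a"
proof -
  have m: "(\<lambda>x. (peak_deriv a x)\<^sup>2) \<in> borel_measurable lebesgue"
    "(\<lambda>x. a\<^sup>2 * (peak a x)\<^sup>2) \<in> borel_measurable lebesgue"
    using peak_measurable[of a] by (auto intro!: borel_measurable_lebesgueI)
  show "integrable lebesgue (\<lambda>x. (peak_deriv a x)\<^sup>2)"
    by (subst integrable_cong_AE[OF m peak_deriv_sq]) (simp add: peak_sq assms)
  show "(LINT x|lebesgue. (peak_deriv a x)\<^sup>2) = a"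
    by (subst integral_cong_AE[OF m peak_deriv_sq])
       (use assms in \<open>simp add: peak_sq, simp add: power2_eq_square\<close>)
qed

lemma peak_L2: "a > 0 \<Longrightarrow> peak a \<in> L2_space" "a > 0 \<Longrightarrow> peak_deriv a \<in> L2_space"
  by (auto simp: L2_space_def peak_sq peak_deriv_sq_integrable intro: borel_measurable_lebesgueI peak_measurable)

lemma DERIV_abs_nonzero:
  assumes "(x::real) \<noteq> 0"
  shows "(abs has_real_derivative sgn x) (at x)"
  using has_derivative_norm[OF assms]
  by (simp add: has_field_derivative_def real_norm_def[abs_def] mult_commute_abs)

text \<open>The product of the peak with a test function is continuous with compact support and
  differentiable away from the kink at \<open>0\<close>, so its derivative has integral zero.\<close>

lemma peak_weak_deriv:
  assumes a: "a > 0"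
  shows "is_weak_deriv (peak a) (peak_deriv a)"
  unfolding is_weak_deriv_def
proof
  fix \<phi> assume \<phi>: "\<phi> \<in> test_functions"
  note d\<phi> = deriv_in_test_functions[OF \<phi>]
  obtain R where R: "R > 0" "\<And>x. x \<notin> {-R..R} \<Longrightarrow> \<phi> x = 0"
    using test_function_bounds[OF \<phi>] by metis
  obtain S where S: "S > 0" "\<And>x. x \<notin> {-S..S} \<Longrightarrow> deriv \<phi> x = 0"
    using test_function_bounds[OF d\<phi>] by metis
  define T where "T = R + S"
  let ?f = "\<lambda>x. peak a x * deriv \<phi> x + peak_deriv a x * \<phi> x"
  have "(?f has_integral (peak a T * \<phi> T - peak a (-T) * \<phi> (-T))) {-T..T}"
  proof (rule fundamental_theorem_of_calculus_interior_strong[where S = "{0}"])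
    fix x assume "x \<in> {-T<..<T} - {0}"
    then have "x \<noteq> 0" by simp
    then have "(peak a has_real_derivative peak_deriv a x) (at x)"
      unfolding peak_def[abs_def] peak_deriv_def
      using \<open>x \<noteq> 0\<close> by (auto intro!: derivative_eq_intros DERIV_abs_nonzero simp: peak_def)
    then show "((\<lambda>x. peak a x * \<phi> x) has_vector_derivative ?f x) (at x)"
      using DERIV_mult[OF _ test_function_DERIV[OF \<phi>, of x]]
      by (fastforce simp: has_real_derivative_iff_has_vector_derivative[symmetric] algebra_simps)
  next
    show "continuous_on {-T..T} (\<lambda>x. peak a x * \<phi> x)"
      unfolding peak_def by (intro continuous_intros continuous_test_function \<phi>)
  qed (use R S in \<open>auto simp: T_def\<close>)
  moreover have "\<phi> T = 0" "\<phi> (-T) = 0"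
    using R S by (auto simp: T_def intro!: R(2))
  ultimately have "(?f has_integral 0) {-T..T}" by simp
  then have "(?f has_integral 0) UNIV"
  proof (rule has_integral_on_superset)
    show "?f x = 0" if "x \<notin> {-T..T}" for x
    proof -
      have "x \<notin> {-R..R}" "x \<notin> {-S..S}" using that R(1) S(1) by (auto simp: T_def)
      then show ?thesis using R(2) S(2) by simp
    qed
  qed simp
  moreover have int: "integrable lebesgue (\<lambda>x. peak a x * deriv \<phi> x)"
    "integrable lebesgue (\<lambda>x. peak_deriv a x * \<phi> x)"
    using peak_L2[OF a] \<phi> d\<phi> by (auto intro: locally_integrable_mult_test L2_imp_locally_integrable)
  ultimately have "(LINT x|lebesgue. ?f x) = 0"
    using has_integral_unique[OF has_integral_integral_lebesgue[OF Bochner_Integration.integrable_add[OF int]]]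
    by blast
  then show "(LINT x|lebesgue. peak a x * deriv \<phi> x) = - (LINT x|lebesgue. peak_deriv a x * \<phi> x)"
    using int by simp
qed

text \<open>A continuous function that is at most \<open>c\<close> almost everywhere is so everywhere, in particular at
  the maximum \<open>0\<close> of the peak.\<close>

lemma Linf_norm_peak_ge: "1 \<le> Linf_norm (peak a)"
proof -
  have "(\<lambda>x. ereal \<bar>peak a x\<bar>) \<in> borel_measurable lebesgue"
    using borel_measurable_lebesgueI[OF peak_measurable(1)] by measurable
  then have ae: "AE x in lebesgue. ereal \<bar>peak a x\<bar> \<le> Linf_norm (peak a)"
    unfolding Linf_norm_def by (intro esssup_AE)
  show ?thesis
  proof (cases "Linf_norm (peak a)")
    case (real c)
    then have "AE x in lebesgue. x \<in> {x. \<bar>peak a x\<bar> \<le> c}" using ae by simp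
    moreover have "closed {x. \<bar>peak a x\<bar> \<le> c}"
      unfolding peak_def by (intro closed_Collect_le continuous_intros)
    ultimately have "0 \<in> {x. \<bar>peak a x\<bar> \<le> c}"
      by (intro mem_closed_if_AE_lebesgue) auto
    then show ?thesis by (simp add: real peak_def one_ereal_def)
  next
    case MInf
    then have "AE x in lebesgue. x \<in> ({} :: real set)" using ae by simp
    then have "0 \<in> ({} :: real set)" by (intro mem_closed_if_AE_lebesgue) auto
    then show ?thesis by simp
  qed simp
qed

section \<open>Bounds on the quotient\<close>

lemma weak_deriv_works:
  assumes "u \<in> H1_space"
  shows "weak_deriv u \<in> L2_space" "is_weak_deriv u (weak_deriv u)"
proof -
  have "\<exists>g. g \<in> L2_space \<and> is_weak_deriv u g" using assms by (auto simp: H1_space_def)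
  from someI_ex[OF this] show "weak_deriv u \<in> L2_space" "is_weak_deriv u (weak_deriv u)"
    by (simp_all add: weak_deriv_def)
qed

lemma potential_integrable:
  assumes V: "V \<in> borel_measurable lebesgue" "AE x in lebesgue. v0 \<le> V x \<and> V x \<le> v1" "0 < v0"
    and u: "u \<in> L2_space"
  shows "integrable lebesgue (\<lambda>x. V x * (u x)\<^sup>2)"
proof (rule Bochner_Integration.integrable_bound)
  show "integrable lebesgue (\<lambda>x. v1 * (u x)\<^sup>2)" using L2_spaceD(2)[OF u] by simp
  show "(\<lambda>x. V x * (u x)\<^sup>2) \<in> borel_measurable lebesgue"
    using V(1) L2_spaceD(1)[OF u] by measurable
  show "AE x in lebesgue. norm (V x * (u x)\<^sup>2) \<le> norm (v1 * (u x)\<^sup>2)"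
    using V(2) by eventually_elim (use V(3) in \<open>auto simp: abs_mult intro!: mult_right_mono\<close>)
qed

text \<open>The energy is at least \<open>2 sqrt v0\<close> times \<open>K\<^sup>2\<close>, where \<open>K\<close> is the bound on the sup norm from
  \<open>weak_deriv_sup_bound\<close>. Extended real division reduces to real division because the sup norm is
  finite, being at most \<open>K\<close>, and positive, \<open>u\<close> not being the zero class.\<close>

lemma quotient_ge:
  assumes V: "V \<in> borel_measurable lebesgue" "AE x in lebesgue. v0 \<le> V x \<and> V x \<le> v1" "0 < v0"
    and u: "u \<in> H1_space" "\<not> (AE x in lebesgue. u x = 0)"
  shows "ereal (2 * sqrt v0) \<le> ereal (V_norm_sq V u) / (Linf_norm u)\<^sup>2"
proof -
  have uL2: "u \<in> L2_space" using u by (simp add: H1_space_def)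
  note g = weak_deriv_works[OF u(1)]
  have [measurable]: "u \<in> borel_measurable lebesgue" using L2_spaceD(1)[OF uL2] .
  define a where "a = sqrt v0"
  have a: "a > 0" "a\<^sup>2 = v0" using V(3) by (auto simp: a_def)
  define W where "W = (LINT x|lebesgue. (weak_deriv u x)\<^sup>2 + a\<^sup>2 * (u x)\<^sup>2)"
  have "W \<ge> 0" unfolding W_def by (intro Bochner_Integration.integral_nonneg) simp
  have "W \<le> V_norm_sq V u"
    unfolding W_def V_norm_sq_def
  proof (rule integral_mono_AE)
    show "AE x in lebesgue. (weak_deriv u x)\<^sup>2 + a\<^sup>2 * (u x)\<^sup>2 \<le> \<bar>weak_deriv u x\<bar>\<^sup>2 + V x * \<bar>u x\<bar>\<^sup>2"
      using V(2) by eventually_elim (auto simp: a intro!: mult_right_mono)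
  qed (use L2_spaceD(2)[OF uL2] L2_spaceD(2)[OF g(1)] potential_integrable[OF V uL2] in simp_all)
  have ae: "AE x in lebesgue. \<bar>u x\<bar> \<le> sqrt (W / (2 * a))"
    using weak_deriv_sup_bound[OF uL2 g a(1)] by (simp add: W_def)
  have meas: "(\<lambda>x. ereal \<bar>u x\<bar>) \<in> borel_measurable lebesgue" by measurable
  have le: "Linf_norm u \<le> ereal (sqrt (W / (2 * a)))"
    unfolding Linf_norm_def by (rule esssup_I[OF meas]) (use ae in simp)
  have "0 < Linf_norm u"
  proof (rule ccontr)
    assume "\<not> 0 < Linf_norm u"
    moreover have "AE x in lebesgue. ereal \<bar>u x\<bar> \<le> Linf_norm u"
      unfolding Linf_norm_def by (rule esssup_AE)
    moreover have "v = 0" if "ereal \<bar>v\<bar> \<le> Linf_norm u" "Linf_norm u \<le> 0" for v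
      using order_trans[OF that] by (simp add: zero_ereal_def)
    ultimately have "AE x in lebesgue. u x = 0"
      by (auto simp: not_less elim: eventually_mono)
    then show False using u(2) by simp
  qed
  with le obtain l where l: "Linf_norm u = ereal l" "0 < l" "l \<le> sqrt (W / (2 * a))"
    by (cases "Linf_norm u") auto
  have "l\<^sup>2 \<le> (sqrt (W / (2 * a)))\<^sup>2" using l by (intro power_mono) auto
  also have "\<dots> = W / (2 * a)" using \<open>W \<ge> 0\<close> a by simp
  finally have "2 * a * l\<^sup>2 \<le> V_norm_sq V u"
    using \<open>W \<le> _\<close> a by (simp add: field_simps)
  then have "2 * a \<le> V_norm_sq V u / l\<^sup>2" using l(2) by (simp add: field_simps)
  then show ?thesis using l by (simp add: a_def)
qed

text \<open>The energy of the peak is at most \<open>\<integral> u'\<^sup>2 + v1 \<integral> u\<^sup>2 = a + v1 / a\<close>; the decay rate \<open>a = sqrt v1\<close>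
  minimizes this.\<close>

lemma m_inf_le:
  assumes V: "V \<in> borel_measurable lebesgue" "AE x in lebesgue. v0 \<le> V x \<and> V x \<le> v1" "0 < v0" "0 < v1"
  shows "m_inf V \<le> ereal (2 * sqrt v1)"
proof -
  define a where "a = sqrt v1"
  have a: "a > 0" "v1 = a * a" using V(4) by (auto simp: a_def)
  let ?u = "peak a"
  have H1: "?u \<in> H1_space"
    using peak_L2[OF a(1)] peak_weak_deriv[OF a(1)] by (auto simp: H1_space_def)
  have nz: "\<not> (AE x in lebesgue. ?u x = 0)"
  proof
    assume "AE x in lebesgue. ?u x = 0"
    then have "AE x in lebesgue. x \<in> ({} :: real set)" by (simp add: peak_def)
    then have "0 \<in> ({} :: real set)" by (intro mem_closed_if_AE_lebesgue) auto
    then show False by simp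
  qed
  note g = weak_deriv_works[OF H1]
  have "V_norm_sq V ?u \<le> (LINT x|lebesgue. (peak_deriv a x)\<^sup>2 + v1 * (?u x)\<^sup>2)"
    unfolding V_norm_sq_def
  proof (rule integral_mono_AE)
    show "AE x in lebesgue. \<bar>weak_deriv ?u x\<bar>\<^sup>2 + V x * \<bar>?u x\<bar>\<^sup>2 \<le> (peak_deriv a x)\<^sup>2 + v1 * (?u x)\<^sup>2"
      using V(2) weak_deriv_unique[OF g peak_L2(2)[OF a(1)] peak_weak_deriv[OF a(1)]]
      by eventually_elim (auto intro!: mult_right_mono)
  qed (use L2_spaceD(2)[OF g(1)] potential_integrable[OF V(1,2,3) peak_L2(1)[OF a(1)]] peak_sq[OF a(1)]
      peak_deriv_sq_integrable[OF a(1)] in simp_all)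
  also have "\<dots> = 2 * a"
    using peak_sq[OF a(1)] peak_deriv_sq_integrable[OF a(1)] a by simp
  finally have num: "V_norm_sq V ?u \<le> 2 * a" .
  have "m_inf V \<le> ereal (V_norm_sq V ?u) / (Linf_norm ?u)\<^sup>2"
    unfolding m_inf_def using H1 nz by (intro INF_lower) simp
  also have "\<dots> \<le> ereal (2 * a)"
  proof (cases "Linf_norm ?u")
    case (real l)
    then have "1 \<le> l" using Linf_norm_peak_ge[of a] by (simp add: one_ereal_def)
    then have "1 \<le> l\<^sup>2" by simp
    then have "V_norm_sq V ?u \<le> 2 * a * l\<^sup>2"
      using num a(1) mult_left_mono[of 1 "l\<^sup>2" "2 * a"] by linarith
    then show ?thesis using real \<open>1 \<le> l\<close> by (simp add: field_simps)
  next
    case PInf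
    then show ?thesis using a by simp
  next
    case MInf
    then show ?thesis using Linf_norm_peak_ge[of a] by simp
  qed
  finally show ?thesis by (simp add: a_def)
qed

theorem theorem4p2:
  fixes V :: "real \<Rightarrow> real" and v0 v1 :: real
  assumes "V \<in> Linf_space"
    and "0 < v0"
    and "AE x in lebesgue. v0 \<le> V x \<and> V x \<le> v1"
  shows "ereal (2 * (v0 / sqrt v1)) \<le> m_inf V \<and> m_inf V \<le> ereal (2 * (v1 / sqrt v0))"
proof -
  have V: "V \<in> borel_measurable lebesgue" using assms(1) by (simp add: Linf_space_def)
  have "v0 \<le> v1"
  proof (rule ccontr)
    assume "\<not> v0 \<le> v1"
    then have "AE x in lebesgue. x \<in> ({} :: real set)" using assms(3) by (elim AE_mp) auto
    then have "0 \<in> ({} :: real set)" by (intro mem_closed_if_AE_lebesgue) auto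
    then show False by simp
  qed
  then have v: "0 < sqrt v0" "sqrt v0 \<le> sqrt v1" "0 < v1" using assms(2) by auto
  have "v0 / sqrt v1 \<le> v0 / sqrt v0" "v1 / sqrt v1 \<le> v1 / sqrt v0"
    using v assms(2) by (auto intro!: divide_left_mono)
  then have "v0 / sqrt v1 \<le> sqrt v0" "sqrt v1 \<le> v1 / sqrt v0"
    using assms(2) v by (simp_all add: real_div_sqrt)
  moreover have "ereal (2 * sqrt v0) \<le> m_inf V"
    unfolding m_inf_def using quotient_ge[OF V assms(3,2)] by (intro INF_greatest) auto
  moreover have "m_inf V \<le> ereal (2 * sqrt v1)"
    using m_inf_le[OF V assms(3,2) v(3)] .
  ultimately show ?thesis
    by (auto elim!: order_trans[rotated] intro: order_trans)
qed

end
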